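(* Let $(m,r)\in\mathcal R_1$ and let $\{X_t\}_{t\ge0}$ be an INAR(1) process with parameters $(m,r)$ and innovation sequence $\{\epsilon_t\}$ such that $E(X_t)<\infty$ and $\mathrm{Var}(X_t)<\infty$ for all $t\ge0$, $\mu_\epsilon<\infty$ and $\sigma_\epsilon^2<\infty$. For any $t\ge1$: (i) $E(X_t\mid X_{t-1})=mX_{t-1}+\mu_\epsilon$. (ii) $\mathrm{Var}(X_t\mid X_{t-1})=m(2r+1-m)X_{t-1}+\sigma_\epsilon^2$. (iii) For $1\le k\le t$, the covariance at lag $k$ is $\mathrm{Cov}(X_{t-k},X_t)=m^k\,\mathrm{Var}(X_{t-k})$. (iv) $$E(X_t)=m^tE(X_0)+\mu_\epsilon\sum_{k=0}^{t-1}m^k$$ and $$\mathrm{Var}(X_t)=m^{2t}\,\mathrm{Var}(X_0)+(2r+1-m)\sum_{k=1}^t m^{2k-1}E(X_{t-k})+\sigma_\epsilon^2\sum_{k=1}^t m^{2(k-1)}.$$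
   Context: $\mathcal R_1=\{(m,r)\in\mathbb R^2: r\ge 0,\ 0<m<1\}$. For $(m,r)\in\mathcal R_1$, $\psi_{m,r}(s)=1-m\frac{1-s}{1+r(1-s)}$, $s\in[0,1]$ (a probability generating function, pgf). An INAR(1) process with parameters $(m,r)$ is a sequence $(X_t,t\ge0)$ of $\mathbb Z_+$-valued random variables such that for every $t\ge1$, $$X_t=(m,r)\odot X_{t-1}+\epsilon_t,\qquad (m,r)\odot X_{t-1}=\sum_{i=1}^{X_{t-1}}Z_{i,t-1},$$ where $(Z_{i,t})$ is an array of iid $\mathbb Z_+$-valued random variables with common pgf $\psi_{m,r}$, $(\epsilon_t,t\ge1)$ is an iid sequence of $\mathbb Z_+$-valued random variables (the innovation sequence), and $X_0$, $(\epsilon_t)$ and $(Z_{i,t})$ are mutually independent. $\mu_\epsilon$ and $\sigma_\epsilon^2$ denote the common mean and variance of the $\epsilon_t$. *)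

theory Defs
  imports "HOL-Probability.Probability"
begin

definition region_R1 :: "(real \<times> real) set" where
  "region_R1 = {(m, r). 0 \<le> r \<and> 0 < m \<and> m < 1}"

definition thinning_pgf :: "real \<Rightarrow> real \<Rightarrow> real \<Rightarrow> real" where
  "thinning_pgf m r s = 1 - m * ((1 - s) / (1 + r * (1 - s)))"

definition pgf :: "'a measure \<Rightarrow> ('a \<Rightarrow> nat) \<Rightarrow> real \<Rightarrow> real" where
  "pgf M Y s = prob_space.expectation M (\<lambda>\<omega>. s ^ Y \<omega>)"

definition random_sum :: "(nat \<Rightarrow> 'a \<Rightarrow> nat) \<Rightarrow> ('a \<Rightarrow> nat) \<Rightarrow> 'a \<Rightarrow> nat" where
  "random_sum Z Y \<omega> = (\<Sum>i = 1..Y \<omega>. Z i \<omega>)"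

definition covariance :: "'a measure \<Rightarrow> ('a \<Rightarrow> real) \<Rightarrow> ('a \<Rightarrow> real) \<Rightarrow> real" where
  "covariance M U V =
     prob_space.expectation M
       (\<lambda>\<omega>. (U \<omega> - prob_space.expectation M U) * (V \<omega> - prob_space.expectation M V))"

definition gen_algebra :: "'a measure \<Rightarrow> ('a \<Rightarrow> nat) \<Rightarrow> 'a measure" where
  "gen_algebra M Y = vimage_algebra (space M) Y (count_space UNIV)"

definition cond_expectation :: "'a measure \<Rightarrow> ('a \<Rightarrow> real) \<Rightarrow> ('a \<Rightarrow> nat) \<Rightarrow> 'a \<Rightarrow> real" where
  "cond_expectation M U Y = real_cond_exp M (gen_algebra M Y) U"

definition cond_variance :: "'a measure \<Rightarrow> ('a \<Rightarrow> real) \<Rightarrow> ('a \<Rightarrow> nat) \<Rightarrow> 'a \<Rightarrow> real" where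
  "cond_variance M U Y = cond_expectation M (\<lambda>\<omega>. (U \<omega> - cond_expectation M U Y \<omega>)\<^sup>2) Y"

datatype source = Initial | Innovation nat | Offspring nat nat

text \<open>
  The array \<open>Z i t\<close> is indexed by \<open>i \<ge> 1\<close>, \<open>t \<ge> 0\<close> and the innovations \<open>\<epsilon> t\<close> by \<open>t \<ge> 1\<close>;
  the values at other indices are unconstrained. Independence within the array, independence
  within the innovation sequence, and mutual independence of the initial value, the array and
  the innovation sequence together say that the joint family of all these variables is
  independent; this is the assumption \<open>indep\<close>. The recursion is an equality of random
  variables, hence only required almost surely.
\<close>

locale inar1 = prob_space M for M :: "'a measure" +
  fixes m r :: real
    and X :: "nat \<Rightarrow> 'a \<Rightarrow> nat"
    and Z :: "nat \<Rightarrow> nat \<Rightarrow> 'a \<Rightarrow> nat"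
    and \<epsilon> :: "nat \<Rightarrow> 'a \<Rightarrow> nat"
  assumes X_rv: "\<And>t. random_variable (count_space UNIV) (X t)"
    and indep: "indep_vars (\<lambda>_. count_space UNIV)
      (\<lambda>j. case j of Initial \<Rightarrow> X 0 | Innovation t \<Rightarrow> \<epsilon> t | Offspring i t \<Rightarrow> Z i t)
      ({Initial} \<union> {Innovation t |t. 1 \<le> t} \<union> {Offspring i t |i t. 1 \<le> i})"
    and Z_ident: "\<And>i j t u. 1 \<le> i \<Longrightarrow> 1 \<le> j \<Longrightarrow>
      distr M (count_space UNIV) (Z i t) = distr M (count_space UNIV) (Z j u)"
    and Z_pgf: "\<And>i t s. 1 \<le> i \<Longrightarrow> s \<in> {0..1} \<Longrightarrow> pgf M (Z i t) s = thinning_pgf m r s"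
    and innov_ident: "\<And>t u. 1 \<le> t \<Longrightarrow> 1 \<le> u \<Longrightarrow>
      distr M (count_space UNIV) (\<epsilon> t) = distr M (count_space UNIV) (\<epsilon> u)"
    and recursion: "\<And>t. 1 \<le> t \<Longrightarrow>
      AE \<omega> in M. X t \<omega> = random_sum (\<lambda>i. Z i (t - 1)) (X (t - 1)) \<omega> + \<epsilon> t \<omega>"

end

theory Submission
  imports Defs
begin

text \<open>
  Given the past up to time \<open>t\<close>, the value \<open>n = X t\<close> is fixed, while the variables that enter at
  time \<open>t + 1\<close>, namely the offspring counts \<open>Z i t\<close> and the innovation \<open>\<epsilon> (t + 1)\<close>, are
  independent of it. So \<open>X (t + 1)\<close> behaves like a sum of \<open>n\<close> independent offspring counts and one
  innovation, whose mean is \<open>m * n + \<mu>\<close> and whose variance is \<open>m * (2 * r + 1 - m) * n + v\<close>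
  (with \<open>\<mu>\<close> and \<open>v\<close> the mean and variance of the innovations). All the claims follow from this.

  Independence is handled through an explicit solution of the recursion: \<open>X t\<close> is almost surely
  a measurable function \<open>path t\<close> of the variables available at time \<open>t\<close> (\<open>AE_X_eq_path\<close>). Disjoint
  blocks of an independent family are independent, so Fubini allows the past to be frozen while
  the new variables are integrated out (\<open>expectation_freeze_independent\<close>,
  \<open>expectation_one_step\<close>). A past factor \<open>u (X s)\<close>, \<open>s \<le> t\<close>, may be carried along. Indicators
  with \<open>s = t\<close> give the conditional mean and variance; the factor \<open>X s - E (X s)\<close> shows that each
  time step multiplies the covariance with \<open>X s\<close> by \<open>m\<close>; the factor 1, with
  \<open>X t - E (X t)\<close> for the mixed term of a square, gives recursions for the mean and the variance,
  which are affine and have the stated solutions.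

  The moments of an offspring count are limits of difference quotients of its generating
  function at 1: \<open>(1 - s ^ y) / (1 - s)\<close> is a geometric sum that increases to \<open>y\<close> as \<open>s\<close> increases
  to 1, so monotone convergence yields integrability together with the value, and one more
  quotient does the same for \<open>y * (y - 1) / 2\<close>.
\<close>

section \<open>Independent random variables\<close>

text \<open>
  The summand that is added is independent of the rest of the sum, so the mixed term in the
  square factorises and cancels. Square integrability of the sum is part of the induction, as
  the variance of the partial sum splits into moments only when these are finite.
\<close>
lemma (in prob_space) variance_sum_indep:
  fixes Y :: "'i \<Rightarrow> 'a \<Rightarrow> real"
  assumes "finite I" and "indep_vars (\<lambda>_. borel) Y I"
    and "\<And>i. i \<in> I \<Longrightarrow> integrable M (Y i)"
    and "\<And>i. i \<in> I \<Longrightarrow> integrable M (\<lambda>\<omega>. (Y i \<omega>)\<^sup>2)"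
  shows "integrable M (\<lambda>\<omega>. (\<Sum>i\<in>I. Y i \<omega>)\<^sup>2) \<and>
    variance (\<lambda>\<omega>. \<Sum>i\<in>I. Y i \<omega>) = (\<Sum>i\<in>I. variance (Y i))"
  using assms
proof (induction I rule: finite_induct)
  case empty
  then show ?case by simp
next
  case (insert j I)
  let ?S = "\<lambda>\<omega>. \<Sum>i\<in>I. Y i \<omega>"
  have IH: "integrable M (\<lambda>\<omega>. (?S \<omega>)\<^sup>2)" "variance ?S = (\<Sum>i\<in>I. variance (Y i))"
    using insert.IH[OF indep_vars_subset[OF insert.prems(1) subset_insertI]] insert.prems by auto
  have S: "integrable M ?S" and Yj: "integrable M (Y j)" "integrable M (\<lambda>\<omega>. (Y j \<omega>)\<^sup>2)"
    using insert.prems by auto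
  have ind: "indep_var borel (Y j) borel ?S"
    using insert by (intro indep_vars_sum) auto
  have cross: "integrable M (\<lambda>\<omega>. Y j \<omega> * ?S \<omega>)"
    "expectation (\<lambda>\<omega>. Y j \<omega> * ?S \<omega>) = expectation (Y j) * expectation ?S"
    using indep_var_integrable[OF ind Yj(1) S] indep_var_lebesgue_integral[OF ind Yj(1) S] by auto
  have sq: "(Y j \<omega> + ?S \<omega>)\<^sup>2 = (Y j \<omega>)\<^sup>2 + (?S \<omega>)\<^sup>2 + 2 * (Y j \<omega> * ?S \<omega>)" for \<omega>
    by (simp add: power2_sum)
  have int: "integrable M (\<lambda>\<omega>. (Y j \<omega> + ?S \<omega>)\<^sup>2)"
    unfolding sq using Yj IH cross by auto
  have "expectation (\<lambda>\<omega>. (Y j \<omega> + ?S \<omega>)\<^sup>2)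
      = expectation (\<lambda>\<omega>. (Y j \<omega>)\<^sup>2) + expectation (\<lambda>\<omega>. (?S \<omega>)\<^sup>2) + 2 * (expectation (Y j) * expectation ?S)"
    unfolding sq cross(2)[symmetric] using Yj(2) IH(1) cross(1)
    by (simp del: Bochner_Integration.integral_sum)
  moreover have "expectation (\<lambda>\<omega>. Y j \<omega> + ?S \<omega>) = expectation (Y j) + expectation ?S"
    by (rule Bochner_Integration.integral_add[OF Yj(1) S])
  ultimately have "variance (\<lambda>\<omega>. Y j \<omega> + ?S \<omega>) = variance (Y j) + variance ?S"
    unfolding variance_eq[OF Bochner_Integration.integrable_add[OF Yj(1) S] int]
      variance_eq[OF Yj] variance_eq[OF S IH(1)]
    by (simp add: power2_sum)
  then show ?case using insert.hyps int IH(2) by simp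
qed

text \<open>
  Independence says that the joint law is the product of the laws, so this is Fubini's theorem
  with both factors transported back to the probability space.
\<close>
lemma (in prob_space) expectation_freeze_independent:
  fixes f :: "'b \<times> 'b \<Rightarrow> real"
  assumes ind: "indep_var S P T F"
    and f [measurable]: "f \<in> borel_measurable (S \<Otimes>\<^sub>M T)"
    and int: "integrable M (\<lambda>\<omega>. f (P \<omega>, F \<omega>))"
  shows "expectation (\<lambda>\<omega>. f (P \<omega>, F \<omega>)) = expectation (\<lambda>\<omega>. expectation (\<lambda>\<omega>'. f (P \<omega>, F \<omega>')))"
proof -
  have [measurable]: "P \<in> measurable M S" "F \<in> measurable M T"
    and law: "distr M S P \<Otimes>\<^sub>M distr M T F = distr M (S \<Otimes>\<^sub>M T) (\<lambda>\<omega>. (P \<omega>, F \<omega>))"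
    using ind unfolding indep_var_distribution_eq by auto
  interpret DP: prob_space "distr M S P" by (rule prob_space_distr) simp
  interpret DF: prob_space "distr M T F" by (rule prob_space_distr) simp
  interpret D: pair_prob_space "distr M S P" "distr M T F" ..
  have int': "integrable (distr M S P \<Otimes>\<^sub>M distr M T F) f"
    unfolding law using int by (simp add: integrable_distr_eq)
  have "expectation (\<lambda>\<omega>. f (P \<omega>, F \<omega>)) = integral\<^sup>L (distr M S P \<Otimes>\<^sub>M distr M T F) f"
    unfolding law by (subst integral_distr) auto
  also have "\<dots> = (\<integral>p. (\<integral>w. f (p, w) \<partial>distr M T F) \<partial>distr M S P)"
    by (rule D.integral_fst'[OF int', symmetric])
  also have "\<dots> = (\<integral>p. expectation (\<lambda>\<omega>'. f (p, F \<omega>')) \<partial>distr M S P)"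
    by (intro Bochner_Integration.integral_cong refl integral_distr) auto
  also have "\<dots> = expectation (\<lambda>\<omega>. expectation (\<lambda>\<omega>'. f (P \<omega>, F \<omega>')))"
    by (subst integral_distr) auto
  finally show ?thesis .
qed

lemma integrable_mult_of_square_integrable:
  fixes f g :: "'a \<Rightarrow> real"
  assumes [measurable]: "f \<in> borel_measurable M" "g \<in> borel_measurable M"
    and sq: "integrable M (\<lambda>x. (f x)\<^sup>2)" "integrable M (\<lambda>x. (g x)\<^sup>2)"
  shows "integrable M (\<lambda>x. f x * g x)"
proof (rule Bochner_Integration.integrable_bound)
  show "integrable M (\<lambda>x. (f x)\<^sup>2 + (g x)\<^sup>2)" using sq by simp
  have "\<bar>a * b\<bar> \<le> a\<^sup>2 + b\<^sup>2" for a b :: real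
  proof -
    have "0 \<le> (\<bar>a\<bar> - \<bar>b\<bar>)\<^sup>2" by simp
    then have "2 * (\<bar>a\<bar> * \<bar>b\<bar>) \<le> a\<^sup>2 + b\<^sup>2" by (simp add: power2_diff)
    moreover have "0 \<le> \<bar>a\<bar> * \<bar>b\<bar>" by simp
    ultimately show ?thesis unfolding abs_mult by linarith
  qed
  then show "AE x in M. norm (f x * g x) \<le> norm ((f x)\<^sup>2 + (g x)\<^sup>2)" by simp
qed measurable

lemma (in finite_measure) integrable_square_of_centered:
  fixes f :: "'a \<Rightarrow> real"
  assumes f: "integrable M f" and sq: "integrable M (\<lambda>x. (f x - c)\<^sup>2)"
  shows "integrable M (\<lambda>x. (f x)\<^sup>2)"
proof -
  have "(f x)\<^sup>2 = (f x - c)\<^sup>2 + 2 * c * f x - c\<^sup>2" for x by (simp add: power2_diff algebra_simps)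
  then show ?thesis using f sq by simp
qed

section \<open>Conditional expectation given a count\<close>

lemma subalgebra_gen_algebra:
  assumes "Y \<in> measurable M (count_space UNIV)"
  shows "subalgebra M (gen_algebra M Y)"
  unfolding subalgebra_def gen_algebra_def
  by (auto simp: sets_vimage_algebra2 intro: measurable_sets[OF assms])

text \<open>
  The events generated by a count \<open>Y\<close> are exactly \<open>Y -` B\<close>, so the defining property of
  conditional expectation becomes an identity between two ordinary expectations weighted with
  the indicator of \<open>B\<close> at \<open>Y\<close>. It is in this form that the one-step formula delivers it.
\<close>
lemma (in prob_space) cond_expectation_charact:
  assumes Y [measurable]: "random_variable (count_space UNIV) Y"
    and U: "integrable M U" and g: "integrable M (\<lambda>\<omega>. g (Y \<omega>))"
    and eq: "\<And>B. expectation (\<lambda>\<omega>. indicator B (Y \<omega>) * U \<omega>) = expectation (\<lambda>\<omega>. indicator B (Y \<omega>) * g (Y \<omega>))"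
  shows "AE \<omega> in M. cond_expectation M U Y \<omega> = g (Y \<omega>)"
proof -
  interpret finite_measure_subalgebra M "gen_algebra M Y"
    by unfold_locales (rule subalgebra_gen_algebra[OF Y])
  show ?thesis
    unfolding cond_expectation_def
  proof (rule real_cond_exp_charact[OF _ U g])
    fix A assume "A \<in> sets (gen_algebra M Y)"
    then obtain B where A: "A = Y -` B \<inter> space M"
      unfolding gen_algebra_def by (auto simp: sets_vimage_algebra2)
    have "set_lebesgue_integral M A h = expectation (\<lambda>\<omega>. indicator B (Y \<omega>) * h \<omega>)" for h :: "'a \<Rightarrow> real"
      unfolding set_lebesgue_integral_def A
      by (intro Bochner_Integration.integral_cong) (auto simp: indicator_def)
    then show "(LINT \<omega>:A|M. U \<omega>) = (LINT \<omega>:A|M. g (Y \<omega>))"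
      using eq by simp
  next
    have "Y \<in> measurable (gen_algebra M Y) (count_space UNIV)"
      unfolding gen_algebra_def by (rule measurable_vimage_algebra1) auto
    then show "(\<lambda>\<omega>. g (Y \<omega>)) \<in> borel_measurable (gen_algebra M Y)"
      by (rule measurable_compose) simp
  qed
qed

section \<open>Moments from the generating function\<close>

lemma sum_less_eq_choose_two: "(\<Sum>j<n. real j) = real n * (real n - 1) / 2"
  by (induction n) (auto simp: field_simps)

text \<open>
  Monotone convergence needs a sequence along which the left limit at 1 is approached from
  below; the shift by 2 keeps it away from 0.
\<close>
lemma filterlim_one_minus_inverse_at_left: "filterlim (\<lambda>n. 1 - 1 / real (n + 2)) (at_left 1) sequentially"
  unfolding filterlim_at by (auto intro!: always_eventually) real_asymp

text \<open>
  The quotient \<open>(1 - s ^ y) / (1 - s)\<close> is the geometric sum of the \<open>s ^ j\<close> with \<open>j < y\<close>, which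
  increases to \<open>y\<close>. Monotone convergence turns the boundedness of the quotients into
  integrability.
\<close>
lemma (in prob_space) pgf_first_moment:
  assumes Y [measurable]: "random_variable (count_space UNIV) Y"
    and lim: "((\<lambda>s. (1 - pgf M Y s) / (1 - s)) \<longlongrightarrow> \<mu>) (at_left 1)"
  shows "integrable M (\<lambda>\<omega>. real (Y \<omega>))" and "expectation (\<lambda>\<omega>. real (Y \<omega>)) = \<mu>"
proof -
  let ?s = "\<lambda>n. 1 - 1 / real (n + 2)"
  let ?f = "\<lambda>n \<omega>. \<Sum>j<Y \<omega>. ?s n ^ j"
  have s: "0 \<le> ?s n" "?s n < 1" for n by auto
  have f: "?f n \<omega> = (1 - ?s n ^ Y \<omega>) / (1 - ?s n)" for n \<omega>
    using s(2)[of n] by (simp add: sum_gp_strict)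
  have pow: "integrable M (\<lambda>\<omega>. ?s n ^ Y \<omega>)" for n
    using s[of n] by (intro integrable_const_bound[where B=1]) (auto intro!: power_le_one)
  have 1: "integrable M (?f n)" for n unfolding f using pow by auto
  have 2: "AE \<omega> in M. mono (\<lambda>n. ?f n \<omega>)"
    using s by (intro AE_I2 monoI sum_mono power_mono) (auto simp: frac_le)
  have 3: "AE \<omega> in M. 0 \<le> ?f n \<omega>" for n
    using s by (intro AE_I2 sum_nonneg zero_le_power) auto
  have "?s \<longlonglongrightarrow> 1" by real_asymp
  then have "(\<lambda>n. ?f n \<omega>) \<longlonglongrightarrow> (\<Sum>j<Y \<omega>. 1 ^ j)" for \<omega>
    by (intro tendsto_sum tendsto_power)
  then have 4: "AE \<omega> in M. (\<lambda>n. ?f n \<omega>) \<longlonglongrightarrow> real (Y \<omega>)"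
    by simp
  have "expectation (?f n) = (1 - pgf M Y (?s n)) / (1 - ?s n)" for n
    unfolding f pgf_def using pow by (simp add: prob_space)
  then have 5: "(\<lambda>n. expectation (?f n)) \<longlonglongrightarrow> \<mu>"
    using filterlim_compose[OF lim filterlim_one_minus_inverse_at_left] by simp
  show "integrable M (\<lambda>\<omega>. real (Y \<omega>))" "expectation (\<lambda>\<omega>. real (Y \<omega>)) = \<mu>"
    by (rule integral_monotone_convergence_nonneg[OF 1 2 3 4 5]; simp)+
qed

text \<open>
  Subtracting the geometric sum from \<open>y\<close> leaves the sum of the \<open>1 - s ^ j\<close> with \<open>j < y\<close>, and after
  division by \<open>1 - s\<close> each of these terms is again a geometric sum, increasing to \<open>j\<close>. The total
  increases to \<open>y * (y - 1) / 2\<close>, which is where the factor 2 in the conclusion comes from.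
\<close>
lemma (in prob_space) pgf_second_factorial_moment:
  assumes Y [measurable]: "random_variable (count_space UNIV) Y"
    and int: "integrable M (\<lambda>\<omega>. real (Y \<omega>))"
    and lim: "((\<lambda>s. (expectation (\<lambda>\<omega>. real (Y \<omega>)) - (1 - pgf M Y s) / (1 - s)) / (1 - s)) \<longlongrightarrow> \<kappa>) (at_left 1)"
  shows "integrable M (\<lambda>\<omega>. real (Y \<omega>) * (real (Y \<omega>) - 1))"
    and "expectation (\<lambda>\<omega>. real (Y \<omega>) * (real (Y \<omega>) - 1)) = 2 * \<kappa>"
proof -
  let ?s = "\<lambda>n. 1 - 1 / real (n + 2)"
  let ?f = "\<lambda>n \<omega>. \<Sum>j<Y \<omega>. \<Sum>i<j. ?s n ^ i"
  let ?u = "\<lambda>\<omega>. real (Y \<omega>) * (real (Y \<omega>) - 1) / 2"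
  have s: "0 \<le> ?s n" "?s n < 1" for n by auto
  have f: "?f n \<omega> = (real (Y \<omega>) - (1 - ?s n ^ Y \<omega>) / (1 - ?s n)) / (1 - ?s n)" for n \<omega>
  proof -
    have "?f n \<omega> = (\<Sum>j<Y \<omega>. (1 - ?s n ^ j) / (1 - ?s n))"
      using s(2)[of n] by (simp add: sum_gp_strict)
    also have "\<dots> = (\<Sum>j<Y \<omega>. 1 - ?s n ^ j) / (1 - ?s n)" by (rule sum_divide_distrib[symmetric])
    also have "(\<Sum>j<Y \<omega>. 1 - ?s n ^ j) = real (Y \<omega>) - (1 - ?s n ^ Y \<omega>) / (1 - ?s n)"
      using s(2)[of n] by (simp add: sum_subtractf sum_gp_strict)
    finally show ?thesis .
  qed
  have pow: "integrable M (\<lambda>\<omega>. ?s n ^ Y \<omega>)" for n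
    using s[of n] by (intro integrable_const_bound[where B=1]) (auto intro!: power_le_one)
  have 1: "integrable M (?f n)" for n unfolding f using pow int by auto
  have 2: "AE \<omega> in M. mono (\<lambda>n. ?f n \<omega>)"
    using s by (intro AE_I2 monoI sum_mono power_mono) (auto simp: frac_le)
  have 3: "AE \<omega> in M. 0 \<le> ?f n \<omega>" for n
    using s by (intro AE_I2 sum_nonneg zero_le_power) auto
  have "?s \<longlonglongrightarrow> 1" by real_asymp
  then have "(\<lambda>n. ?f n \<omega>) \<longlonglongrightarrow> (\<Sum>j<Y \<omega>. \<Sum>i<j. 1 ^ i)" for \<omega>
    by (intro tendsto_sum tendsto_power)
  then have 4: "AE \<omega> in M. (\<lambda>n. ?f n \<omega>) \<longlonglongrightarrow> ?u \<omega>"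
    by (simp add: sum_less_eq_choose_two)
  have "expectation (?f n) = (expectation (\<lambda>\<omega>. real (Y \<omega>)) - (1 - pgf M Y (?s n)) / (1 - ?s n)) / (1 - ?s n)" for n
    unfolding f pgf_def using pow int by (simp add: prob_space)
  then have 5: "(\<lambda>n. expectation (?f n)) \<longlonglongrightarrow> \<kappa>"
    using filterlim_compose[OF lim filterlim_one_minus_inverse_at_left] by simp
  have "integrable M ?u" "expectation ?u = \<kappa>"
    by (rule integral_monotone_convergence_nonneg[OF 1 2 3 4 5]; simp)+
  then show "integrable M (\<lambda>\<omega>. real (Y \<omega>) * (real (Y \<omega>) - 1))"
    "expectation (\<lambda>\<omega>. real (Y \<omega>) * (real (Y \<omega>) - 1)) = 2 * \<kappa>"
    using Bochner_Integration.integrable_mult_right[of 2 M ?u] by auto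
qed

text \<open>
  For the thinning generating function the two quotients are \<open>m / (1 + r * (1 - s))\<close> and
  \<open>m * r / (1 + r * (1 - s))\<close>, with limits \<open>m\<close> and \<open>m * r\<close>.
\<close>
lemma (in prob_space) thinning_moments:
  assumes Y [measurable]: "random_variable (count_space UNIV) Y"
    and pgf: "\<And>s. s \<in> {0..1} \<Longrightarrow> pgf M Y s = thinning_pgf m r s" and r: "0 \<le> r"
  shows "integrable M (\<lambda>\<omega>. real (Y \<omega>))" and "integrable M (\<lambda>\<omega>. (real (Y \<omega>))\<^sup>2)"
    and "expectation (\<lambda>\<omega>. real (Y \<omega>)) = m"
    and "variance (\<lambda>\<omega>. real (Y \<omega>)) = m * (2 * r + 1 - m)"
proof -
  have pos: "0 < 1 + r * (1 - s)" if "s < 1" for s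
    using r that by (intro add_pos_nonneg mult_nonneg_nonneg) auto
  have near1: "\<forall>\<^sub>F s in at_left 1. s \<in> {0<..<1::real}"
    by (rule eventually_at_leftI[of 0]) auto
  have quot: "(1 - pgf M Y s) / (1 - s) = m / (1 + r * (1 - s))" if "s \<in> {0<..<1}" for s
    using that pos[of s] pgf[of s] by (simp add: thinning_pgf_def field_simps)
  have "((\<lambda>s. m / (1 + r * (1 - s))) \<longlongrightarrow> m) (at_left 1)"
    by (auto intro!: tendsto_eq_intros)
  then have lim1: "((\<lambda>s. (1 - pgf M Y s) / (1 - s)) \<longlongrightarrow> m) (at_left 1)"
    by (rule Lim_transform_eventually) (use near1 quot in \<open>auto elim!: eventually_mono\<close>)
  show int: "integrable M (\<lambda>\<omega>. real (Y \<omega>))" and mean: "expectation (\<lambda>\<omega>. real (Y \<omega>)) = m"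
    using pgf_first_moment[OF Y lim1] by auto
  have quot2: "(m - (1 - pgf M Y s) / (1 - s)) / (1 - s) = m * r / (1 + r * (1 - s))"
    if "s \<in> {0<..<1}" for s
  proof -
    have "m - m / (1 + r * (1 - s)) = m * r * (1 - s) / (1 + r * (1 - s))"
      using pos[of s] that by (simp add: field_simps)
    then show ?thesis unfolding quot[OF that] using that by simp
  qed
  have "((\<lambda>s. m * r / (1 + r * (1 - s))) \<longlongrightarrow> m * r) (at_left 1)"
    by (auto intro!: tendsto_eq_intros)
  then have lim2: "((\<lambda>s. (m - (1 - pgf M Y s) / (1 - s)) / (1 - s)) \<longlongrightarrow> m * r) (at_left 1)"
    by (rule Lim_transform_eventually) (use near1 quot2 in \<open>auto elim!: eventually_mono\<close>)
  have fact: "integrable M (\<lambda>\<omega>. real (Y \<omega>) * (real (Y \<omega>) - 1))"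
    "expectation (\<lambda>\<omega>. real (Y \<omega>) * (real (Y \<omega>) - 1)) = 2 * (m * r)"
    using pgf_second_factorial_moment[OF Y int, of "m * r"] lim2 mean by auto
  have sq: "(real (Y \<omega>))\<^sup>2 = real (Y \<omega>) * (real (Y \<omega>) - 1) + real (Y \<omega>)" for \<omega>
    by (simp add: power2_eq_square algebra_simps)
  show int2: "integrable M (\<lambda>\<omega>. (real (Y \<omega>))\<^sup>2)"
    unfolding sq using fact(1) int by (rule Bochner_Integration.integrable_add)
  have "expectation (\<lambda>\<omega>. (real (Y \<omega>))\<^sup>2) = 2 * (m * r) + m"
    unfolding sq using fact int mean by simp
  then show "variance (\<lambda>\<omega>. real (Y \<omega>)) = m * (2 * r + 1 - m)"
    using variance_eq[OF int int2] mean by (simp add: power2_eq_square algebra_simps)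
qed

section \<open>The process as a function of its sources\<close>

text \<open>
  The time at which a source variable first influences the process: \<open>Offspring i t\<close> acts on
  \<open>X t\<close> but is felt only in \<open>X (t + 1)\<close>.
\<close>
fun birth :: "source \<Rightarrow> nat" where
  "birth Initial = 0"
| "birth (Innovation t) = t"
| "birth (Offspring i t) = Suc t"

definition sources :: "source set" where
  "sources = {Initial} \<union> {Innovation t |t. 1 \<le> t} \<union> {Offspring i t |i t. 1 \<le> i}"

definition past :: "nat \<Rightarrow> source set" where
  "past t = {j \<in> sources. birth j \<le> t}"

definition fresh :: "nat \<Rightarrow> source set" where
  "fresh t = {j \<in> sources. birth j = Suc t}"

text \<open>
  The sources whose values add up to \<open>X (t + 1)\<close> when \<open>X t = n\<close>. Treating the innovation as one
  more summand lets the recursion be a single sum over a random set of independent variables.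
\<close>
definition summands :: "nat \<Rightarrow> nat \<Rightarrow> source set" where
  "summands t n = insert (Innovation (Suc t)) ((\<lambda>i. Offspring i t) ` {1..n})"

text \<open>
  The solution of the recursion as a function of a point \<open>w\<close> of the product space of all source
  values. Unlike \<open>X\<close>, it satisfies the recursion everywhere, and it depends visibly on the past only.
\<close>
primrec path :: "nat \<Rightarrow> (source \<Rightarrow> nat) \<Rightarrow> nat" where
  "path 0 w = w Initial"
| "path (Suc t) w = (\<Sum>j\<in>summands t (path t w). w j)"

lemma finite_summands [simp]: "finite (summands t n)"
  by (simp add: summands_def)

lemma sum_summands: "(\<Sum>j\<in>summands t n. f j) = f (Innovation (Suc t)) + (\<Sum>i=1..n. f (Offspring i t))"
  unfolding summands_def by (subst sum.insert) (auto simp: sum.reindex inj_on_def)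

lemma summands_subset_fresh: "summands t n \<subseteq> fresh t"
  by (auto simp: summands_def fresh_def sources_def)

lemma summands_subset_past: "Suc t \<le> u \<Longrightarrow> summands t n \<subseteq> past u"
  by (auto simp: summands_def past_def sources_def)

lemma path_cong:
  assumes "s \<le> t" "\<And>j. j \<in> past t \<Longrightarrow> w j = w' j"
  shows "path s w = path s w'"
  using assms(1)
proof (induction s)
  case 0
  then show ?case using assms(2) by (simp add: past_def sources_def)
next
  case (Suc s)
  then show ?case
    using summands_subset_past[of s t] assms(2) by (auto intro!: sum.cong)
qed

text \<open>
  The random index set takes countably many values, so measurability can be checked for each
  fixed set.
\<close>
lemma measurable_random_set_sum:
  assumes [measurable]: "n \<in> measurable N (count_space UNIV)"
    and W: "\<And>k j. j \<in> A k \<Longrightarrow> (\<lambda>x. W x j) \<in> measurable N (count_space UNIV)"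
  shows "(\<lambda>x. \<Sum>j\<in>A (n x :: nat). W x j :: nat) \<in> measurable N (count_space UNIV)"
proof (rule measurable_compose_countable[where f = "\<lambda>k x. \<Sum>j\<in>A k. W x j"])
  fix k
  have "(\<lambda>x. \<Sum>j\<in>A k. W x j) \<in> borel_measurable N"
    by (intro borel_measurable_sum measurable_compose[OF W]) auto
  then show "(\<lambda>x. \<Sum>j\<in>A k. W x j) \<in> measurable N (count_space UNIV)"
    by (simp add: measurable_def sets_borel_eq_count_space)
qed simp

lemma path_measurable [measurable]:
  "s \<le> t \<Longrightarrow> path s \<in> measurable (PiM (past t) (\<lambda>_. count_space UNIV)) (count_space UNIV)"
proof (induction s)
  case 0
  have "Initial \<in> past t" by (simp add: past_def sources_def)
  then show ?case by simp
next
  case (Suc s)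
  then have [measurable]: "path s \<in> measurable (PiM (past t) (\<lambda>_. count_space UNIV)) (count_space UNIV)"
    by simp
  show ?case
    unfolding path.simps
    using summands_subset_past[of s t] Suc.prems
    by (intro measurable_random_set_sum) (auto intro!: measurable_component_singleton)
qed

context inar1
begin

definition source_value :: "source \<Rightarrow> 'a \<Rightarrow> nat" where
  "source_value j = (case j of Initial \<Rightarrow> X 0 | Innovation t \<Rightarrow> \<epsilon> t | Offspring i t \<Rightarrow> Z i t)"

lemma source_value_simps [simp]:
  "source_value Initial = X 0" "source_value (Innovation t) = \<epsilon> t"
  "source_value (Offspring i t) = Z i t"
  by (auto simp: source_value_def)

definition history :: "nat \<Rightarrow> 'a \<Rightarrow> source \<Rightarrow> nat" where
  "history t \<omega> = (\<lambda>j\<in>past t. source_value j \<omega>)"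

lemma indep_source_value: "indep_vars (\<lambda>_. count_space UNIV) source_value sources"
  using indep unfolding source_value_def[abs_def] sources_def .

lemma source_value_rv: "j \<in> sources \<Longrightarrow> random_variable (count_space UNIV) (source_value j)"
  using indep_source_value by (auto simp: indep_vars_def)

lemma history_measurable [measurable]:
  "history t \<in> measurable M (PiM (past t) (\<lambda>_. count_space UNIV))"
  unfolding history_def by (intro measurable_restrict source_value_rv) (auto simp: past_def)

lemma AE_X_eq_path: "AE \<omega> in M. X t \<omega> = path t (\<lambda>j. source_value j \<omega>)"
proof (induction t)
  case (Suc t)
  have "AE \<omega> in M. X (Suc t) \<omega> = random_sum (\<lambda>i. Z i t) (X t) \<omega> + \<epsilon> (Suc t) \<omega>"
    using recursion[of "Suc t"] by simp
  with Suc show ?case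
    by eventually_elim (simp add: sum_summands random_sum_def)
qed simp

lemma AE_X_eq_path_history:
  assumes "s \<le> t"
  shows "AE \<omega> in M. X s \<omega> = path s (history t \<omega>)"
  using AE_X_eq_path[of s]
  by eventually_elim (auto simp: history_def intro!: path_cong[OF assms])

lemma AE_X_Suc_eq_sum_summands:
  "AE \<omega> in M. X (Suc t) \<omega> = (\<Sum>j\<in>summands t (X t \<omega>). source_value j \<omega>)"
  using AE_X_eq_path[of "Suc t"] AE_X_eq_path[of t] by eventually_elim simp

text \<open>
  The core of the argument. Up to null sets the left integrand is a function of the history
  and of the fresh sources, two disjoint and hence independent blocks; freezing the history
  leaves the expectation over the fresh sources for a fixed value of \<open>X t\<close>. The factor at an
  earlier time \<open>s\<close> is a function of the same history, which is what gives access to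
  covariances at lags larger than 1.
\<close>
lemma expectation_one_step:
  fixes u :: "nat \<Rightarrow> real" and h :: "nat \<Rightarrow> nat \<Rightarrow> real"
  assumes "s \<le> t"
    and int: "integrable M (\<lambda>\<omega>. u (X s \<omega>) * h (X t \<omega>) (X (Suc t) \<omega>))"
  shows "expectation (\<lambda>\<omega>. u (X s \<omega>) * h (X t \<omega>) (X (Suc t) \<omega>))
    = expectation (\<lambda>\<omega>. u (X s \<omega>) *
        expectation (\<lambda>\<omega>'. h (X t \<omega>) (\<Sum>j\<in>summands t (X t \<omega>). source_value j \<omega>')))"
proof -
  let ?P = "PiM (past t) (\<lambda>_. count_space UNIV) :: (source \<Rightarrow> nat) measure"
  let ?F = "PiM (fresh t) (\<lambda>_. count_space UNIV) :: (source \<Rightarrow> nat) measure"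
  let ?fresh = "\<lambda>\<omega>. \<lambda>j\<in>fresh t. source_value j \<omega>"
  let ?f = "\<lambda>(p, w). u (path s p) * h (path t p) (\<Sum>j\<in>summands t (path t p). w j)"
  let ?g = "\<lambda>n. expectation (\<lambda>\<omega>'. h n (\<Sum>j\<in>summands t n. source_value j \<omega>'))"
  have [measurable]: "?fresh \<in> measurable M ?F"
    by (auto intro!: measurable_restrict source_value_rv simp: fresh_def)
  have [measurable]: "X k \<in> measurable M (count_space UNIV)" for k by (rule X_rv)
  have [measurable]: "path s \<in> measurable ?P (count_space UNIV)" "path t \<in> measurable ?P (count_space UNIV)"
    using \<open>s \<le> t\<close> by (auto intro: path_measurable)
  have ind: "indep_var ?P (history t) ?F ?fresh"
    unfolding history_def[abs_def]
    by (rule indep_var_restrict[OF indep_source_value]) (auto simp: past_def fresh_def)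
  have n: "(\<lambda>x. path t (fst x)) \<in> measurable (?P \<Otimes>\<^sub>M ?F) (count_space UNIV)"
    by measurable
  have S: "(\<lambda>x. \<Sum>j\<in>summands t (path t (fst x)). snd x j) \<in> measurable (?P \<Otimes>\<^sub>M ?F) (count_space UNIV)"
    using summands_subset_fresh[of t]
    by (intro measurable_random_set_sum n)
      (auto intro!: measurable_compose[OF measurable_snd] measurable_component_singleton)
  have [measurable]: "(\<lambda>x. h (path t (fst x)) (\<Sum>j\<in>summands t (path t (fst x)). snd x j))
      \<in> borel_measurable (?P \<Otimes>\<^sub>M ?F)"
    by (rule measurable_compose_countable[OF measurable_compose_countable[OF _ S] n, of "\<lambda>i j x. h i j"]) simp
  have f: "?f \<in> borel_measurable (?P \<Otimes>\<^sub>M ?F)"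
    unfolding case_prod_beta' by measurable
  \<comment> \<open>All summands of \<open>X (Suc t)\<close> are fresh, so restricting to the fresh block keeps their values.\<close>
  have sum_fresh: "(\<Sum>j\<in>summands t n. ?fresh \<omega> j) = (\<Sum>j\<in>summands t n. source_value j \<omega>)" for n \<omega>
    using summands_subset_fresh[of t n] by (auto intro!: sum.cong)
  have f_eq: "?f (history t \<omega>, ?fresh \<omega>') = u (path s (history t \<omega>)) * h (path t (history t \<omega>))
      (\<Sum>j\<in>summands t (path t (history t \<omega>)). source_value j \<omega>')" for \<omega> \<omega>'
    by (simp only: prod.case sum_fresh)
  have eq: "AE \<omega> in M. u (X s \<omega>) * h (X t \<omega>) (X (Suc t) \<omega>) = ?f (history t \<omega>, ?fresh \<omega>)"
    unfolding f_eq
    using AE_X_Suc_eq_sum_summands[of t] AE_X_eq_path_history[OF order_refl, of t]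
      AE_X_eq_path_history[OF \<open>s \<le> t\<close>]
    by eventually_elim simp
  have meas_f: "(\<lambda>\<omega>. ?f (history t \<omega>, ?fresh \<omega>)) \<in> borel_measurable M"
    by (rule measurable_compose[OF _ f]) measurable
  have int_f: "integrable M (\<lambda>\<omega>. ?f (history t \<omega>, ?fresh \<omega>))"
    using integrable_cong_AE_imp[OF int meas_f] eq by auto
  have "expectation (\<lambda>\<omega>. u (X s \<omega>) * h (X t \<omega>) (X (Suc t) \<omega>))
      = expectation (\<lambda>\<omega>. ?f (history t \<omega>, ?fresh \<omega>))"
    by (rule integral_cong_AE[OF _ meas_f eq]) (rule borel_measurable_integrable[OF int])
  also have "\<dots> = expectation (\<lambda>\<omega>. expectation (\<lambda>\<omega>'. ?f (history t \<omega>, ?fresh \<omega>')))"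
    by (rule expectation_freeze_independent[OF ind f int_f])
  also have "\<dots> = expectation (\<lambda>\<omega>. u (path s (history t \<omega>)) * ?g (path t (history t \<omega>)))"
    unfolding f_eq by simp
  also have "\<dots> = expectation (\<lambda>\<omega>. u (X s \<omega>) * ?g (X t \<omega>))"
  proof (rule integral_cong_AE)
    have g: "(\<lambda>\<omega>. ?g (N \<omega>)) \<in> borel_measurable M" if "N \<in> measurable M (count_space UNIV)" for N
      using that by (rule measurable_compose) simp
    have [measurable]: "(\<lambda>\<omega>. path k (history t \<omega>)) \<in> measurable M (count_space UNIV)" if "k \<le> t" for k
      by (rule measurable_compose[OF history_measurable path_measurable[OF that]])
    show "(\<lambda>\<omega>. u (path s (history t \<omega>)) * ?g (path t (history t \<omega>))) \<in> borel_measurable M"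
      using \<open>s \<le> t\<close> by (intro borel_measurable_times g) measurable
    show "(\<lambda>\<omega>. u (X s \<omega>) * ?g (X t \<omega>)) \<in> borel_measurable M"
      by (intro borel_measurable_times g) measurable
    show "AE \<omega> in M. u (path s (history t \<omega>)) * ?g (path t (history t \<omega>)) = u (X s \<omega>) * ?g (X t \<omega>)"
      using AE_X_eq_path_history[OF order_refl, of t] AE_X_eq_path_history[OF \<open>s \<le> t\<close>]
      by eventually_elim simp
  qed
  finally show ?thesis .
qed

end

section \<open>One step of the process\<close>

lemma affine_recursion_solution:
  fixes a b :: "nat \<Rightarrow> real"
  assumes "\<And>t. a (Suc t) = q * a t + b t"
  shows "a t = q ^ t * a 0 + (\<Sum>k<t. q ^ k * b (t - Suc k))"
  by (induction t)
    (simp_all add: assms sum.lessThan_Suc_shift sum_distrib_left algebra_simps del: sum.lessThan_Suc)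

locale finite_variance_inar1 = inar1 M m r X Z \<epsilon>
  for M :: "'a measure" and m r X Z \<epsilon> +
  fixes \<mu> v :: real
  assumes r_nonneg: "0 \<le> r"
    and X_int: "\<And>n. integrable M (\<lambda>\<omega>. real (X n \<omega>))"
    and X_sq: "\<And>n. integrable M (\<lambda>\<omega>. (real (X n \<omega>))\<^sup>2)"
    and innov_int: "\<And>n. 1 \<le> n \<Longrightarrow> integrable M (\<lambda>\<omega>. real (\<epsilon> n \<omega>))"
    and innov_sq: "\<And>n. 1 \<le> n \<Longrightarrow> integrable M (\<lambda>\<omega>. (real (\<epsilon> n \<omega>))\<^sup>2)"
    and innov_mean: "\<And>n. 1 \<le> n \<Longrightarrow> expectation (\<lambda>\<omega>. real (\<epsilon> n \<omega>)) = \<mu>"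
    and innov_variance: "\<And>n. 1 \<le> n \<Longrightarrow> variance (\<lambda>\<omega>. real (\<epsilon> n \<omega>)) = v"
begin

lemma offspring_moments:
  assumes "1 \<le> i"
  shows "integrable M (\<lambda>\<omega>. real (Z i t \<omega>))" and "integrable M (\<lambda>\<omega>. (real (Z i t \<omega>))\<^sup>2)"
    and "expectation (\<lambda>\<omega>. real (Z i t \<omega>)) = m"
    and "variance (\<lambda>\<omega>. real (Z i t \<omega>)) = m * (2 * r + 1 - m)"
proof -
  have "random_variable (count_space UNIV) (Z i t)"
    using source_value_rv[of "Offspring i t"] assms by (simp add: sources_def)
  note thinning_moments[OF this Z_pgf[OF assms] r_nonneg]
  then show "integrable M (\<lambda>\<omega>. real (Z i t \<omega>))" "integrable M (\<lambda>\<omega>. (real (Z i t \<omega>))\<^sup>2)"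
    "expectation (\<lambda>\<omega>. real (Z i t \<omega>)) = m"
    "variance (\<lambda>\<omega>. real (Z i t \<omega>)) = m * (2 * r + 1 - m)"
    by auto
qed

lemma sum_summands_mean:
  "expectation (\<lambda>\<omega>. real (\<Sum>j\<in>summands t n. source_value j \<omega>)) = m * real n + \<mu>"
proof -
  have "expectation (\<lambda>\<omega>. real (\<Sum>j\<in>summands t n. source_value j \<omega>))
      = (\<Sum>j\<in>summands t n. expectation (\<lambda>\<omega>. real (source_value j \<omega>)))"
    unfolding of_nat_sum using innov_int[of "Suc t"] offspring_moments(1)
    by (intro Bochner_Integration.integral_sum) (auto simp: summands_def)
  also have "\<dots> = m * real n + \<mu>"
    using innov_mean[of "Suc t"] offspring_moments(3) by (simp add: sum_summands)
  finally show ?thesis .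
qed

lemma sum_summands_variance:
  "expectation (\<lambda>\<omega>. (real (\<Sum>j\<in>summands t n. source_value j \<omega>) - (m * real n + \<mu>))\<^sup>2)
    = m * (2 * r + 1 - m) * real n + v"
proof -
  have sub: "summands t n \<subseteq> sources"
    using summands_subset_fresh[of t n] by (auto simp: fresh_def)
  have "indep_vars (\<lambda>_. borel) (\<lambda>j \<omega>. real (source_value j \<omega>)) (summands t n)"
    by (rule indep_vars_compose2[OF indep_vars_subset[OF indep_source_value sub]]) simp
  moreover have "integrable M (\<lambda>\<omega>. real (source_value j \<omega>))" "integrable M (\<lambda>\<omega>. (real (source_value j \<omega>))\<^sup>2)"
    if "j \<in> summands t n" for j
    using that innov_int[of "Suc t"] innov_sq[of "Suc t"] offspring_moments
    by (auto simp: summands_def)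
  ultimately have "variance (\<lambda>\<omega>. \<Sum>j\<in>summands t n. real (source_value j \<omega>))
      = (\<Sum>j\<in>summands t n. variance (\<lambda>\<omega>. real (source_value j \<omega>)))"
    using variance_sum_indep[OF finite_summands] by blast
  also have "\<dots> = m * (2 * r + 1 - m) * real n + v"
    using innov_variance[of "Suc t"] offspring_moments(4) by (simp add: sum_summands)
  finally show ?thesis
    using sum_summands_mean[of t n] by simp
qed

lemma X_measurable [measurable]: "random_variable (count_space UNIV) (X t)"
  by (rule X_rv)

lemma integrable_indicator_state_mult:
  assumes "integrable M f"
  shows "integrable M (\<lambda>\<omega>. indicator B (X t \<omega>) * f \<omega> :: real)"
  using assms by (rule Bochner_Integration.integrable_bound)
    (use assms in \<open>auto intro!: borel_measurable_times split: split_indicator\<close>)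

text \<open>
  In integrated form: given everything up to time \<open>t\<close>, the conditional mean of \<open>X (t + 1)\<close>
  is an affine function of \<open>X t\<close> alone.
\<close>
lemma one_step_mean:
  assumes "s \<le> t" and "integrable M (\<lambda>\<omega>. u (X s \<omega>) * real (X (Suc t) \<omega>))"
  shows "expectation (\<lambda>\<omega>. u (X s \<omega>) * real (X (Suc t) \<omega>))
    = expectation (\<lambda>\<omega>. u (X s \<omega>) * (m * real (X t \<omega>) + \<mu>))"
  using expectation_one_step[OF assms(1), of u "\<lambda>_ b. real b"] assms(2)
  unfolding sum_summands_mean .

lemma residual_square_integrable:
  "integrable M (\<lambda>\<omega>. (real (X (Suc t) \<omega>) - (m * real (X t \<omega>) + \<mu>))\<^sup>2)"
proof -
  have "integrable M (\<lambda>\<omega>. real (X (Suc t) \<omega>) * real (X t \<omega>))"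
    by (rule integrable_mult_of_square_integrable) (auto intro: X_sq)
  moreover have "(real (X (Suc t) \<omega>) - (m * real (X t \<omega>) + \<mu>))\<^sup>2
     = (real (X (Suc t) \<omega>))\<^sup>2 + m\<^sup>2 * (real (X t \<omega>))\<^sup>2 + \<mu>\<^sup>2 - 2 * m * (real (X (Suc t) \<omega>) * real (X t \<omega>))
       - 2 * \<mu> * real (X (Suc t) \<omega>) + 2 * m * \<mu> * real (X t \<omega>)" for \<omega>
    by (simp add: power2_eq_square algebra_simps)
  ultimately show ?thesis using X_sq X_int by simp
qed

lemma one_step_variance:
  assumes "integrable M (\<lambda>\<omega>. u (X t \<omega>) * (real (X (Suc t) \<omega>) - (m * real (X t \<omega>) + \<mu>))\<^sup>2)"
  shows "expectation (\<lambda>\<omega>. u (X t \<omega>) * (real (X (Suc t) \<omega>) - (m * real (X t \<omega>) + \<mu>))\<^sup>2)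
    = expectation (\<lambda>\<omega>. u (X t \<omega>) * (m * (2 * r + 1 - m) * real (X t \<omega>) + v))"
  using expectation_one_step[OF order_refl, of u t "\<lambda>a b. (real b - (m * real a + \<mu>))\<^sup>2"] assms
  unfolding sum_summands_variance .

section \<open>Conditional mean and variance\<close>

lemma conditional_mean:
  "AE \<omega> in M. cond_expectation M (\<lambda>\<omega>. real (X (Suc t) \<omega>)) (X t) \<omega> = m * real (X t \<omega>) + \<mu>"
  using cond_expectation_charact[where g = "\<lambda>n. m * real n + \<mu>", OF X_rv X_int[of "Suc t"], of t]
    one_step_mean[OF order_refl, of "indicator _" t] X_int integrable_indicator_state_mult
  by simp

text \<open>
  The conditional variance subtracts a version of the conditional mean; replacing it by the
  affine function of \<open>X t\<close> changes the square on a null set only, and then the characterisation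
  by indicators applies.
\<close>
lemma conditional_variance:
  "AE \<omega> in M. cond_variance M (\<lambda>\<omega>. real (X (Suc t) \<omega>)) (X t) \<omega>
     = m * (2 * r + 1 - m) * real (X t \<omega>) + v"
proof -
  let ?D = "\<lambda>\<omega>. (real (X (Suc t) \<omega>) - (m * real (X t \<omega>) + \<mu>))\<^sup>2"
  let ?E = "\<lambda>\<omega>. (real (X (Suc t) \<omega>) - cond_expectation M (\<lambda>\<omega>. real (X (Suc t) \<omega>)) (X t) \<omega>)\<^sup>2"
  interpret finite_measure_subalgebra M "gen_algebra M (X t)"
    by unfold_locales (rule subalgebra_gen_algebra[OF X_rv])
  have "AE \<omega> in M. ?E \<omega> = ?D \<omega>"
    using conditional_mean[of t] by eventually_elim simp
  then have "AE \<omega> in M. cond_expectation M ?E (X t) \<omega> = cond_expectation M ?D (X t) \<omega>"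
    unfolding cond_expectation_def
    by (rule real_cond_exp_cong) measurable
  moreover have "AE \<omega> in M. cond_expectation M ?D (X t) \<omega> = m * (2 * r + 1 - m) * real (X t \<omega>) + v"
    using cond_expectation_charact[where g = "\<lambda>n. m * (2 * r + 1 - m) * real n + v",
        OF X_rv residual_square_integrable[of t]]
      one_step_variance[of "indicator _" t] X_int integrable_indicator_state_mult[OF residual_square_integrable]
    by simp
  ultimately show ?thesis
    unfolding cond_variance_def by eventually_elim simp
qed

section \<open>Mean, covariance and variance in time\<close>

abbreviation mean :: "nat \<Rightarrow> real" where
  "mean t \<equiv> expectation (\<lambda>\<omega>. real (X t \<omega>))"

lemma mean_Suc: "mean (Suc t) = m * mean t + \<mu>"
  using one_step_mean[OF order_refl, of "\<lambda>_. 1" t] X_int by (simp add: prob_space)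

lemma integrable_centered_mult:
  "integrable M (\<lambda>\<omega>. (real (X s \<omega>) - a) * real (X t \<omega>))"
proof -
  have "integrable M (\<lambda>\<omega>. real (X s \<omega>) * real (X t \<omega>))"
    by (rule integrable_mult_of_square_integrable) (auto intro: X_sq)
  then show ?thesis using X_int by (simp add: left_diff_distrib)
qed

lemma centered_times_affine:
  "expectation (\<lambda>\<omega>. (real (X s \<omega>) - mean s) * (c * real (X t \<omega>) + d))
    = c * expectation (\<lambda>\<omega>. (real (X s \<omega>) - mean s) * real (X t \<omega>))"
proof -
  have "(real (X s \<omega>) - mean s) * (c * real (X t \<omega>) + d)
     = c * ((real (X s \<omega>) - mean s) * real (X t \<omega>)) + d * (real (X s \<omega>) - mean s)" for \<omega>
    by (simp add: algebra_simps)
  moreover have "expectation (\<lambda>\<omega>. real (X s \<omega>) - mean s) = 0"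
    using X_int by (simp add: prob_space)
  ultimately show ?thesis
    using integrable_centered_mult[of s "mean s" t] X_int by simp
qed

text \<open>
  Since \<open>X s\<close> is centered, the constant \<open>\<mu>\<close> of the one-step mean contributes nothing, and each
  step costs exactly one factor \<open>m\<close>.
\<close>
lemma centered_product_decay:
  "expectation (\<lambda>\<omega>. (real (X s \<omega>) - mean s) * real (X (s + k) \<omega>))
    = m ^ k * variance (\<lambda>\<omega>. real (X s \<omega>))"
proof (induction k)
  case 0
  then show ?case
    using centered_times_affine[of s 1 s "- mean s"] by (simp add: power2_eq_square)
next
  case (Suc k)
  then show ?case
    using one_step_mean[of s "s + k" "\<lambda>n. real n - mean s"] centered_times_affine[of s m "s + k" \<mu>]
      integrable_centered_mult by simp
qed

lemma covariance_lag:
  "covariance M (\<lambda>\<omega>. real (X s \<omega>)) (\<lambda>\<omega>. real (X (s + k) \<omega>)) = m ^ k * variance (\<lambda>\<omega>. real (X s \<omega>))"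
  using centered_times_affine[of s 1 "s + k" "- mean (s + k)"] centered_product_decay[of s k]
  unfolding covariance_def by simp

text \<open>
  Decomposition \<open>X (t + 1) - E X (t + 1) = m * C + D\<close> into the centered state \<open>C\<close> and the residual
  \<open>D\<close> of the conditional mean. The residual is orthogonal to \<open>C\<close> by the one-step mean, so the squares add up; the mean of \<open>D\<^sup>2\<close> is the averaged conditional variance.
\<close>
lemma variance_Suc:
  "variance (\<lambda>\<omega>. real (X (Suc t) \<omega>))
    = m\<^sup>2 * variance (\<lambda>\<omega>. real (X t \<omega>)) + (m * (2 * r + 1 - m) * mean t + v)"
proof -
  let ?C = "\<lambda>\<omega>. real (X t \<omega>) - mean t"
  let ?D = "\<lambda>\<omega>. real (X (Suc t) \<omega>) - (m * real (X t \<omega>) + \<mu>)"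
  have C: "integrable M (\<lambda>\<omega>. (?C \<omega>)\<^sup>2)"
    using X_int X_sq by (simp add: power2_diff)
  have D: "expectation (\<lambda>\<omega>. (?D \<omega>)\<^sup>2) = m * (2 * r + 1 - m) * mean t + v"
    using one_step_variance[of "\<lambda>_. 1" t] residual_square_integrable[of t] X_int
    by (simp add: prob_space)
  have split: "?C \<omega> * ?D \<omega> = ?C \<omega> * real (X (Suc t) \<omega>) - ?C \<omega> * (m * real (X t \<omega>) + \<mu>)" for \<omega>
    by (simp add: algebra_simps)
  have affine: "integrable M (\<lambda>\<omega>. ?C \<omega> * (m * real (X t \<omega>) + \<mu>))"
  proof -
    have "?C \<omega> * (m * real (X t \<omega>) + \<mu>) = m * (?C \<omega> * real (X t \<omega>)) + \<mu> * ?C \<omega>" for \<omega>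
      by (simp add: algebra_simps)
    then show ?thesis using integrable_centered_mult X_int by simp
  qed
  have CD: "integrable M (\<lambda>\<omega>. ?C \<omega> * ?D \<omega>)" "expectation (\<lambda>\<omega>. ?C \<omega> * ?D \<omega>) = 0"
    using integrable_centered_mult[of t "mean t" "Suc t"] affine
      one_step_mean[OF order_refl, of "\<lambda>n. real n - mean t" t]
    unfolding split by auto
  have "(real (X (Suc t) \<omega>) - mean (Suc t))\<^sup>2 = m\<^sup>2 * (?C \<omega>)\<^sup>2 + (?D \<omega>)\<^sup>2 + 2 * m * (?C \<omega> * ?D \<omega>)" for \<omega>
    unfolding mean_Suc by (simp add: power2_eq_square algebra_simps)
  then have "variance (\<lambda>\<omega>. real (X (Suc t) \<omega>)) = expectation (\<lambda>\<omega>. m\<^sup>2 * (?C \<omega>)\<^sup>2 + (?D \<omega>)\<^sup>2 + 2 * m * (?C \<omega> * ?D \<omega>))"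
    by simp
  also have "\<dots> = m\<^sup>2 * expectation (\<lambda>\<omega>. (?C \<omega>)\<^sup>2) + expectation (\<lambda>\<omega>. (?D \<omega>)\<^sup>2) + 2 * m * expectation (\<lambda>\<omega>. ?C \<omega> * ?D \<omega>)"
    using C CD(1) residual_square_integrable[of t] by simp
  finally show ?thesis using D CD(2) by simp
qed

lemma mean_closed_form: "mean t = m ^ t * mean 0 + \<mu> * (\<Sum>k<t. m ^ k)"
  using affine_recursion_solution[of mean m "\<lambda>_. \<mu>" t] mean_Suc
  by (simp add: sum_distrib_left mult.commute)

lemma variance_closed_form:
  "variance (\<lambda>\<omega>. real (X t \<omega>)) = m ^ (2 * t) * variance (\<lambda>\<omega>. real (X 0 \<omega>))
    + (2 * r + 1 - m) * (\<Sum>k = 1..t. m ^ (2 * k - 1) * mean (t - k))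
    + v * (\<Sum>k = 1..t. m ^ (2 * (k - 1)))"
proof -
  have "variance (\<lambda>\<omega>. real (X t \<omega>)) = (m\<^sup>2) ^ t * variance (\<lambda>\<omega>. real (X 0 \<omega>))
    + (\<Sum>k<t. (m\<^sup>2) ^ k * (m * (2 * r + 1 - m) * mean (t - Suc k) + v))"
    by (rule affine_recursion_solution[of "\<lambda>t. variance (\<lambda>\<omega>. real (X t \<omega>))"]) (rule variance_Suc)
  also have "(\<Sum>k<t. (m\<^sup>2) ^ k * (m * (2 * r + 1 - m) * mean (t - Suc k) + v))
    = (2 * r + 1 - m) * (\<Sum>k<t. m ^ (2 * k + 1) * mean (t - Suc k)) + v * (\<Sum>k<t. m ^ (2 * k))"
    unfolding sum_distrib_left sum.distrib[symmetric]
    power_mult[symmetric]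
    by (intro sum.cong refl) (simp add: algebra_simps)
  finally show ?thesis
    by (simp add: sum.atLeast1_atMost_eq power_mult)
qed

end

theorem proposition3p2:
  fixes M :: "'a measure"
    and m r \<mu>\<^sub>\<epsilon> var\<^sub>\<epsilon> :: real
    and X :: "nat \<Rightarrow> 'a \<Rightarrow> nat"
    and Z :: "nat \<Rightarrow> nat \<Rightarrow> 'a \<Rightarrow> nat"
    and \<epsilon> :: "nat \<Rightarrow> 'a \<Rightarrow> nat"
    and t :: nat
  assumes params: "(m, r) \<in> region_R1"
    and process: "inar1 M m r X Z \<epsilon>"
    and X_mean: "\<And>n. integrable M (\<lambda>\<omega>. real (X n \<omega>))"
    and X_var: "\<And>n. integrable M
      (\<lambda>\<omega>. (real (X n \<omega>) - prob_space.expectation M (\<lambda>\<omega>. real (X n \<omega>)))\<^sup>2)"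
    and innov_mean: "\<And>n. 1 \<le> n \<Longrightarrow> integrable M (\<lambda>\<omega>. real (\<epsilon> n \<omega>))"
      "\<And>n. 1 \<le> n \<Longrightarrow> prob_space.expectation M (\<lambda>\<omega>. real (\<epsilon> n \<omega>)) = \<mu>\<^sub>\<epsilon>"
    and innov_var: "\<And>n. 1 \<le> n \<Longrightarrow> integrable M (\<lambda>\<omega>. (real (\<epsilon> n \<omega>) - \<mu>\<^sub>\<epsilon>)\<^sup>2)"
      "\<And>n. 1 \<le> n \<Longrightarrow> prob_space.variance M (\<lambda>\<omega>. real (\<epsilon> n \<omega>)) = var\<^sub>\<epsilon>"
    and t: "1 \<le> t"
  shows
    "(AE \<omega> in M. cond_expectation M (\<lambda>\<omega>. real (X t \<omega>)) (X (t - 1)) \<omega>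
        = m * real (X (t - 1) \<omega>) + \<mu>\<^sub>\<epsilon>)
   \<and> (AE \<omega> in M. cond_variance M (\<lambda>\<omega>. real (X t \<omega>)) (X (t - 1)) \<omega>
        = m * (2 * r + 1 - m) * real (X (t - 1) \<omega>) + var\<^sub>\<epsilon>)
   \<and> (\<forall>k. 1 \<le> k \<and> k \<le> t \<longrightarrow>
        covariance M (\<lambda>\<omega>. real (X (t - k) \<omega>)) (\<lambda>\<omega>. real (X t \<omega>))
        = m ^ k * prob_space.variance M (\<lambda>\<omega>. real (X (t - k) \<omega>)))
   \<and> prob_space.expectation M (\<lambda>\<omega>. real (X t \<omega>))
        = m ^ t * prob_space.expectation M (\<lambda>\<omega>. real (X 0 \<omega>)) + \<mu>\<^sub>\<epsilon> * (\<Sum>k = 0..t - 1. m ^ k)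
   \<and> prob_space.variance M (\<lambda>\<omega>. real (X t \<omega>))
        = m ^ (2 * t) * prob_space.variance M (\<lambda>\<omega>. real (X 0 \<omega>))
        + (2 * r + 1 - m)
            * (\<Sum>k = 1..t. m ^ (2 * k - 1) * prob_space.expectation M (\<lambda>\<omega>. real (X (t - k) \<omega>)))
        + var\<^sub>\<epsilon> * (\<Sum>k = 1..t. m ^ (2 * (k - 1)))"
proof -
  interpret inar1 M m r X Z \<epsilon> by (rule process)
  interpret finite_variance_inar1 M m r X Z \<epsilon> \<mu>\<^sub>\<epsilon> var\<^sub>\<epsilon>
  proof unfold_locales
    show "0 \<le> r" using params by (simp add: region_R1_def)
    show "integrable M (\<lambda>\<omega>. (real (X n \<omega>))\<^sup>2)" for n
      by (rule integrable_square_of_centered[OF X_mean X_var])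
    show "integrable M (\<lambda>\<omega>. (real (\<epsilon> n \<omega>))\<^sup>2)" if "1 \<le> n" for n
      by (rule integrable_square_of_centered[OF innov_mean(1)[OF that] innov_var(1)[OF that]])
  qed (use X_mean innov_mean innov_var in auto)
  have Suc: "Suc (t - 1) = t" and range: "{0..t - 1} = {..<t}" using t by auto
  have lag: "covariance M (\<lambda>\<omega>. real (X (t - k) \<omega>)) (\<lambda>\<omega>. real (X t \<omega>))
      = m ^ k * variance (\<lambda>\<omega>. real (X (t - k) \<omega>))" if "k \<le> t" for k
    using covariance_lag[of "t - k" k] that by simp
  show ?thesis
    using conditional_mean[of "t - 1"] conditional_variance[of "t - 1"] mean_closed_form[of t]
      variance_closed_form[of t] lag
    unfolding Suc range by blast
qed

end
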